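(* Let $0<\delta<1$ and $L>0$ be constants such that $\epsilon:=\frac{(L\log(1/\delta))^{\delta}}{2}-1$ satisfies $0<\epsilon<3$ (for instance $L$ slightly larger than $3.998$ with a suitable $\delta$), and let $l_0$ be a natural number with $2\le (1+\epsilon/3)^{\,l_0-\lfloor \delta l_0\rfloor}$. Let $X$ be a set of size $N$, let $p\in[0,1]$, and let $0<\epsilon_1<1/l_0$ (possibly depending on $N$). Assume $H$ is an $l$-bounded family of subsets of $X$ with $f(H)>1/2$. Then $\langle H\rangle$ contains at least a $1-\epsilon_1$ fraction of the level $L_{m_l}$, where $$m_l=\Big\lfloor LpN\log(l+1)+96\,pN\log\big(\tfrac{1}{\epsilon_1}\big)\Big\rfloor,$$ i.e. $|\langle H\rangle\cap L_{m_l}|\ge(1-\epsilon_1)|L_{m_l}|$.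
   Context: $\log$ denotes the logarithm to base $2$. For a finite set $X$, the $m$-level $L_m$ is the family of all subsets of $X$ of size $m$. A family $H$ of subsets of $X$ is $l$-bounded if all its members have size at most $l$. For a family $G$ of subsets of $X$, $\langle G\rangle=\{T\subseteq X: T\supseteq S \text{ for some } S\in G\}$, and $G$ covers $H$ if $H\subseteq\langle G\rangle$. For $p\in[0,1]$, the cost $f(H)$ of $H$ is the minimum of $\sum_{S\in G}p^{|S|}$ over all families $G$ of subsets of $X$ that cover $H$. *)

theory Defs
  imports Complex_Main
begin

definition level :: "'a set \<Rightarrow> nat \<Rightarrow> 'a set set" where
  "level X m = {S. S \<subseteq> X \<and> card S = m}"

definition bounded_family :: "nat \<Rightarrow> 'a set set \<Rightarrow> bool" where
  "bounded_family l H \<longleftrightarrow> (\<forall>S\<in>H. card S \<le> l)"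

definition upset :: "'a set \<Rightarrow> 'a set set \<Rightarrow> 'a set set" where
  "upset X G = {T. T \<subseteq> X \<and> (\<exists>S\<in>G. S \<subseteq> T)}"

definition covers :: "'a set \<Rightarrow> 'a set set \<Rightarrow> 'a set set \<Rightarrow> bool" where
  "covers X G H \<longleftrightarrow> H \<subseteq> upset X G"

(* For finite X and H \<subseteq> Pow X the set of costs is finite and nonempty (H covers itself),
   so Min is a genuine minimum. *)
definition cost :: "'a set \<Rightarrow> real \<Rightarrow> 'a set set \<Rightarrow> real" where
  "cost X p H = Min ((\<lambda>G. \<Sum>S\<in>G. p ^ card S) ` {G. G \<subseteq> Pow X \<and> covers X G H})"

end

theory Submission
  imports Defs
begin

text \<open>The random set is exposed in rounds. If \<open>W\<close> is the part exposed in one round, the inclusion-minimal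
  sets among the \<open>S - W\<close> with \<open>S \<in> H\<close> (the fragments) satisfy the counting bound of Park and Pham, so
  that the fragments of size greater than \<open>s\<close> are cheap in expectation. Either they can be discarded at
  a small loss of cost, leaving an \<open>s\<close>-bounded family, or the round is wasted and repeated. Once the
  family is \<open>0\<close>-bounded and still has positive cost, it contains the empty set.

  As long as \<open>l\<close> exceeds \<open>l0 (log (1/\<epsilon>1) + 3)\<close>, rounds of size \<open>p N L log (1/\<delta>)\<close> reduce \<open>l\<close> to
  \<open>\<lfloor>\<delta> l\<rfloor>\<close>; the expected cost of a round is at most \<open>(1 + \<epsilon>)^(-l) \<le> (1 + \<epsilon>/3)^(-2l)\<close>, so the failure
  probabilities and the lost costs can both be taken to be \<open>(1 + \<epsilon>/3)^(-l)\<close>, which form a geometric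
  progression with sum at most \<open>\<epsilon>1/4\<close>. These rounds use up at most \<open>L p N log l\<close>. From then on, rounds
  of size \<open>12 p N\<close> halve \<open>l\<close>, with repetition; as \<open>\<epsilon>1 < 1/l0\<close>, the share \<open>96 p N log (1/\<epsilon>1)\<close>
  suffices to bring their failure probability below \<open>\<epsilon>1/2\<close>.\<close>

section \<open>Residual families and averaging over an exposed set\<close>

definition residual :: "'a set \<Rightarrow> 'a set set \<Rightarrow> 'a set set" where
  "residual W H = (\<lambda>S. S - W) ` H"

definition misses :: "'a set \<Rightarrow> 'a set set \<Rightarrow> nat \<Rightarrow> 'a set set" where
  "misses X H m = level X m - upset X H"

lemma finite_level: "finite X \<Longrightarrow> finite (level X m)"
  unfolding level_def by (rule finite_subset[of _ "Pow X"]) auto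

lemma card_level: "finite X \<Longrightarrow> card (level X m) = card X choose m"
  unfolding level_def by (rule n_subsets)

lemma finite_misses: "finite X \<Longrightarrow> finite (misses X H m)"
  by (simp add: misses_def finite_level)

lemma misses_empty: "misses X {} m = level X m"
  by (simp add: misses_def upset_def)

lemma misses_le_level: "finite X \<Longrightarrow> card (misses X H m) \<le> card (level X m)"
  by (rule card_mono) (auto simp: misses_def finite_level)

text \<open>Double counting of pairs \<open>W \<subseteq> T\<close>: a set \<open>T\<close>
  containing \<open>W\<close> includes a member of \<open>H\<close> exactly when
  \<open>T - W\<close> includes a member of the residual family.\<close>

lemma sum_card_misses_residual:
  assumes "finite X"
  shows "(\<Sum>W\<in>level X w. card (misses (X - W) (residual W H) m)) =
    card (misses X H (w + m)) * ((w + m) choose w)"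
proof -
  let ?A = "Sigma (misses X H (w + m)) (\<lambda>T. level T w)"
  let ?B = "Sigma (level X w) (\<lambda>W. misses (X - W) (residual W H) m)"
  have fin: "finite T" if "T \<subseteq> X" for T
    using that assms by (rule finite_subset)
  have "bij_betw (\<lambda>(T, W). (W, T - W)) ?A ?B"
  proof (rule bij_betw_byWitness[where f' = "\<lambda>(W, V). (W \<union> V, W)"])
    show "\<forall>a\<in>?A. (\<lambda>(W, V). (W \<union> V, W)) ((\<lambda>(T, W). (W, T - W)) a) = a"
      by (auto simp: level_def)
    show "\<forall>a\<in>?B. (\<lambda>(T, W). (W, T - W)) ((\<lambda>(W, V). (W \<union> V, W)) a) = a"
      by (auto simp: level_def misses_def)
    show "(\<lambda>(T, W). (W, T - W)) ` ?A \<subseteq> ?B"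
    proof clarify
      fix T W assume T: "T \<in> misses X H (w + m)" and W: "W \<in> level T w"
      have "W \<subseteq> T" "finite W" "card T = w + m" "card W = w"
        using T W fin[of W] by (auto simp: misses_def level_def)
      then have "card (T - W) = m" by (simp add: card_Diff_subset)
      moreover have "T - W \<notin> upset (X - W) (residual W H)"
      proof
        assume "T - W \<in> upset (X - W) (residual W H)"
        then obtain S where "S \<in> H" "S - W \<subseteq> T - W" by (auto simp: upset_def residual_def)
        then have "S \<subseteq> T" using \<open>W \<subseteq> T\<close> by blast
        then show False
          using T \<open>S \<in> H\<close> by (auto simp: misses_def level_def upset_def)
      qed
      ultimately show "W \<in> level X w \<and> T - W \<in> misses (X - W) (residual W H) m"
        using T W by (auto simp: misses_def level_def)
    qed
    show "(\<lambda>(W, V). (W \<union> V, W)) ` ?B \<subseteq> ?A"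
    proof clarify
      fix W V assume W: "W \<in> level X w" and V: "V \<in> misses (X - W) (residual W H) m"
      have sub: "V \<subseteq> X - W" "W \<subseteq> X" "card V = m" "card W = w"
        using V W by (auto simp: misses_def level_def)
      have "card (W \<union> V) = w + m"
        using sub fin[of V] fin[of W] by (subst card_Un_disjoint) auto
      moreover have "W \<union> V \<notin> upset X H"
      proof
        assume "W \<union> V \<in> upset X H"
        then obtain S where "S \<in> H" "S \<subseteq> W \<union> V" by (auto simp: upset_def)
        then have "V \<in> upset (X - W) (residual W H)"
          using sub by (auto simp: upset_def residual_def)
        then show False using V by (simp add: misses_def)
      qed
      ultimately show "W \<union> V \<in> misses X H (w + m) \<and> W \<in> level (W \<union> V) w"
        using sub by (auto simp: misses_def level_def)
    qed
  qed
  then have "card ?A = card ?B" by (rule bij_betw_same_card)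
  moreover have "card ?A = (\<Sum>T\<in>misses X H (w + m). card (level T w))"
    using assms fin by (intro card_SigmaI) (auto simp: finite_misses finite_level misses_def level_def)
  moreover have "\<dots> = (\<Sum>T\<in>misses X H (w + m). (w + m) choose w)"
    using fin by (intro sum.cong) (auto simp: card_level misses_def level_def[of X])
  moreover have "card ?B = (\<Sum>W\<in>level X w. card (misses (X - W) (residual W H) m))"
    using assms by (intro card_SigmaI) (auto simp: finite_misses finite_level)
  ultimately show ?thesis by simp
qed

lemma misses_mono:
  assumes "\<And>S. S \<in> G \<Longrightarrow> \<exists>S'\<in>H. S' \<subseteq> S"
  shows "misses X H m \<subseteq> misses X G m"
  using assms by (fastforce simp: misses_def upset_def)

text \<open>The law of total probability: a uniform \<open>(w + m)\<close>-set is a uniform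
  \<open>w\<close>-set followed by a uniform \<open>m\<close>-set of the rest, and
  \<open>\<beta> W\<close> bounds the conditional failure probability.\<close>

lemma misses_averaging:
  fixes b :: real
  assumes "finite X"
    and le: "\<And>W. W \<in> level X w \<Longrightarrow>
      real (card (misses (X - W) (residual W H) m)) \<le> \<beta> W * real (card (level (X - W) m))"
    and avg: "(\<Sum>W\<in>level X w. \<beta> W) \<le> b * real (card (level X w))"
  shows "real (card (misses X H (w + m))) \<le> b * real (card (level X (w + m)))"
proof -
  let ?M = "real ((card X - w) choose m)"
  let ?C = "real ((w + m) choose w)"
  have M: "card (level (X - W) m) = (card X - w) choose m" if "W \<in> level X w" for W
    using that assms(1) finite_subset[of W X] by (auto simp: card_level level_def[of X] card_Diff_subset)
  \<comment> \<open>With the empty family every set is missed, so the same double count compares the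
    levels themselves.\<close>
  have "(\<Sum>W\<in>level X w. card (level (X - W) m)) = card (level X (w + m)) * ((w + m) choose w)"
    using sum_card_misses_residual[OF assms(1), where w = w and H = "{}" and m = m]
    by (simp add: misses_empty residual_def)
  moreover have "(\<Sum>W\<in>level X w. card (level (X - W) m)) = card (level X w) * ((card X - w) choose m)"
    using M by simp
  ultimately have tot: "real (card (level X w)) * ?M = real (card (level X (w + m))) * ?C"
    by (metis of_nat_mult)
  have "real (card (misses X H (w + m))) * ?C =
      (\<Sum>W\<in>level X w. real (card (misses (X - W) (residual W H) m)))"
    using arg_cong[OF sum_card_misses_residual[OF assms(1), where w = w and H = H and m = m], of real]
    by simp
  also have "\<dots> \<le> (\<Sum>W\<in>level X w. \<beta> W * ?M)"
    using le M by (intro sum_mono) force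
  also have "\<dots> = (\<Sum>W\<in>level X w. \<beta> W) * ?M"
    by (simp add: sum_distrib_right)
  also have "\<dots> \<le> b * real (card (level X w)) * ?M"
    by (intro mult_right_mono avg) auto
  also have "\<dots> = (b * real (card (level X (w + m)))) * ?C"
    using tot by (simp add: mult.assoc)
  finally show ?thesis
    by (simp add: mult_le_cancel_right)
qed

section \<open>Covers and their cost\<close>

lemma cost_le:
  assumes "finite X" "G \<subseteq> Pow X" "covers X G H"
  shows "cost X p H \<le> (\<Sum>S\<in>G. p ^ card S)"
proof -
  have "finite {G. G \<subseteq> Pow X \<and> covers X G H}"
    using assms(1) by (rule_tac finite_subset[of _ "Pow (Pow X)"]) auto
  then show ?thesis
    unfolding cost_def using assms(2,3) by (intro Min_le) auto
qed

lemma cost_attained: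
  assumes "finite X" "H \<subseteq> Pow X"
  obtains G where "G \<subseteq> Pow X" "covers X G H" "cost X p H = (\<Sum>S\<in>G. p ^ card S)"
proof -
  let ?\<G> = "{G. G \<subseteq> Pow X \<and> covers X G H}"
  have "finite ?\<G>"
    using assms(1) by (rule_tac finite_subset[of _ "Pow (Pow X)"]) auto
  moreover have "H \<in> ?\<G>"
    using assms(2) by (auto simp: covers_def upset_def)
  ultimately have "cost X p H \<in> (\<lambda>G. \<Sum>S\<in>G. p ^ card S) ` ?\<G>"
    unfolding cost_def by (intro Min_in) auto
  then show ?thesis using that by auto
qed

text \<open>A cheapest cover of \<open>F\<close> together with \<open>U\<close> covers
  \<open>H\<close>, so dropping \<open>U\<close> loses at most its weight.\<close>

lemma cost_le_residual:
  assumes "finite X" "0 \<le> p" "H \<subseteq> Pow X" "F \<subseteq> Pow Y" "Y \<subseteq> X" "U \<subseteq> Pow X"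
    and ex: "\<And>S. S \<in> H \<Longrightarrow> \<exists>T\<in>F \<union> U. T \<subseteq> S"
  shows "cost X p H \<le> cost Y p F + (\<Sum>T\<in>U. p ^ card T)"
proof -
  have "finite Y" using assms(1,5) finite_subset by blast
  then obtain G where G: "G \<subseteq> Pow Y" "covers Y G F" "cost Y p F = (\<Sum>S\<in>G. p ^ card S)"
    using assms(4) by (rule cost_attained)
  have fin: "finite G" "finite U"
    using G(1) assms(6) \<open>finite Y\<close> \<open>finite X\<close> by (auto intro: finite_subset)
  have "covers X (G \<union> U) H"
    unfolding covers_def
  proof
    fix S assume "S \<in> H"
    with ex obtain T where T: "T \<in> F \<union> U" "T \<subseteq> S" by blast
    have "\<exists>T'\<in>G. T' \<subseteq> T" if "T \<in> F"
      using that G(2) by (auto simp: covers_def upset_def)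
    with T have "\<exists>T\<in>G \<union> U. T \<subseteq> S" by blast
    then show "S \<in> upset X (G \<union> U)"
      using \<open>S \<in> H\<close> assms(3) by (auto simp: upset_def)
  qed
  then have "cost X p H \<le> (\<Sum>S\<in>G \<union> U. p ^ card S)"
    using assms(1,5,6) G(1) by (intro cost_le) auto
  also have "\<dots> \<le> (\<Sum>S\<in>G. p ^ card S) + (\<Sum>S\<in>U. p ^ card S)"
    using fin assms(2) by (subst sum_Un) (auto intro!: sum_nonneg)
  finally show ?thesis using G(3) by simp
qed

section \<open>Fragments: counting and expected cost\<close>

definition minimal_sets :: "'a set set \<Rightarrow> 'a set set" where
  "minimal_sets F = {T \<in> F. \<forall>S\<in>F. S \<subseteq> T \<longrightarrow> S = T}"

lemma minimal_sets_below:
  assumes "finite F" "S \<in> F"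
  shows "\<exists>T\<in>minimal_sets F. T \<subseteq> S"
  using finite_has_minimal2[OF assms] by (auto simp: minimal_sets_def)

lemma residual_Pow: "H \<subseteq> Pow X \<Longrightarrow> residual W H \<subseteq> Pow (X - W)"
  by (auto simp: residual_def)

lemma bounded_residual:
  assumes "finite X" "H \<subseteq> Pow X" "bounded_family l H"
  shows "bounded_family l (residual W H)"
  unfolding bounded_family_def residual_def
proof clarify
  fix S assume S: "S \<in> H"
  then have "card (S - W) \<le> card S"
    using assms(1,2) by (intro card_mono) (auto intro: finite_subset)
  also have "\<dots> \<le> l" using S assms(3) by (auto simp: bounded_family_def)
  finally show "card (S - W) \<le> l" .
qed

text \<open>The pair \<open>(W, T)\<close> is encoded by \<open>Z = W \<union> T\<close> and \<open>T\<close>. If \<open>S \<in> H\<close> is any member inside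
  \<open>Z\<close>, then \<open>S - W \<subseteq> T\<close>, so minimality forces \<open>T = S - W \<subseteq> S\<close>; hence \<open>Z\<close> leaves at most
  \<open>l choose t\<close> possibilities for \<open>T\<close>.\<close>
lemma sum_card_minimal_residuals_le:
  assumes "finite X" "H \<subseteq> Pow X" "bounded_family l H"
  shows "(\<Sum>W\<in>level X w. card {T \<in> minimal_sets (residual W H). card T = t})
    \<le> (card X choose (w + t)) * (l choose t)"
proof -
  let ?M = "\<lambda>W. {T \<in> minimal_sets (residual W H). card T = t}"
  let ?A = "Sigma (level X w) ?M"
  define Q where "Q = {Z \<in> level X (w + t). \<exists>S\<in>H. S \<subseteq> Z}"
  define s where "s Z = (SOME S. S \<in> H \<and> S \<subseteq> Z)" for Z
  have s: "s Z \<in> H" "s Z \<subseteq> Z" if "Z \<in> Q" for Z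
    using that someI_ex[of "\<lambda>S. S \<in> H \<and> S \<subseteq> Z"] by (auto simp: s_def Q_def)
  let ?B = "Sigma Q (\<lambda>Z. level (s Z) t)"
  have fin: "finite T" if "T \<subseteq> X" for T
    using that assms(1) by (rule finite_subset)
  have finM: "finite (?M W)" for W
    using residual_Pow[OF assms(2), of W] assms(1)
    by (intro finite_subset[of "?M W" "Pow X"]) (auto simp: minimal_sets_def)
  have finQ: "finite Q" by (simp add: Q_def finite_level assms(1))
  have fins: "finite (s Z)" if "Z \<in> Q" for Z
    using s(1)[OF that] assms(2) fin by auto
  have disj: "T \<subseteq> X - W" if "T \<in> ?M W" for T W
    using that residual_Pow[OF assms(2), of W] by (auto simp: minimal_sets_def)
  have "card ?A \<le> card ?B"
  proof (rule card_inj_on_le[where f = "\<lambda>(W, T). (W \<union> T, T)"])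
    show "inj_on (\<lambda>(W, T). (W \<union> T, T)) ?A"
    proof (rule inj_onI, clarify)
      fix W T W' T'
      assume "T \<in> minimal_sets (residual W H)" "t = card T" "T \<in> minimal_sets (residual W' H)"
        and eq: "W \<union> T = W' \<union> T"
      then have "T \<inter> W = {}" "T \<inter> W' = {}" using disj[of T W] disj[of T W'] by auto
      with eq show "W = W' \<and> T = T" by blast
    qed
    show "(\<lambda>(W, T). (W \<union> T, T)) ` ?A \<subseteq> ?B"
    proof clarify
      fix W T assume W: "W \<in> level X w" and T: "T \<in> minimal_sets (residual W H)" "t = card T"
      have TX: "T \<subseteq> X - W" using T disj by auto
      have "card (W \<union> T) = w + card T"
        using W TX fin[of W] fin[of T] by (subst card_Un_disjoint) (auto simp: level_def)
      moreover obtain S where "S \<in> H" "T = S - W"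
        using T by (auto simp: minimal_sets_def residual_def)
      ultimately have Q: "W \<union> T \<in> Q"
        using W TX T(2) by (auto simp: Q_def level_def)
      have "s (W \<union> T) - W \<in> residual W H" "s (W \<union> T) - W \<subseteq> T"
        using s[OF Q] by (auto simp: residual_def)
      then have "s (W \<union> T) - W = T"
        using T by (auto simp: minimal_sets_def)
      then show "W \<union> T \<in> Q \<and> T \<in> level (s (W \<union> T)) (card T)"
        using Q T(2) by (auto simp: level_def)
    qed
    show "finite ?B" using finQ fins by (intro finite_SigmaI finite_level) auto
  qed
  also have "card ?B = (\<Sum>Z\<in>Q. card (level (s Z) t))"
    using finQ fins by (intro card_SigmaI) (auto simp: finite_level)
  also have "\<dots> \<le> (\<Sum>Z\<in>Q. l choose t)"
    using s fins assms(3)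
    by (intro sum_mono) (auto simp: card_level bounded_family_def intro!: binomial_right_mono)
  also have "\<dots> \<le> (card X choose (w + t)) * (l choose t)"
    using card_mono[of "level X (w + t)" Q] assms(1)
    by (simp add: Q_def finite_level card_level)
  also have "card ?A = (\<Sum>W\<in>level X w. card (?M W))"
    using assms(1) finM by (intro card_SigmaI) (auto simp: finite_level)
  finally show ?thesis .
qed

text \<open>Passing from index \<open>w + t\<close> to \<open>w + t + 1\<close> multiplies the
  binomial by \<open>(n - w - t) / (w + t + 1)\<close>, and this ratio times \<open>x * p\<close> is
  at most 1.\<close>

lemma binomial_shift_le:
  fixes p x :: real
  assumes "0 < x" "0 \<le> p" "x * p * real n \<le> real w + 1"
  shows "p ^ t * real (n choose (w + t)) \<le> real (n choose w) / x ^ t"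
proof (induction t)
  case (Suc t)
  have abs: "real (w + t + 1) * real (n choose (w + t + 1)) = real (n - (w + t)) * real (n choose (w + t))"
    using binomial_absorb_comp[of n "w + t"] binomial_absorption[of "w + t" n]
    by (metis Suc_eq_plus1 of_nat_mult)
  have "x * p * real (n - (w + t)) \<le> x * p * real n"
    using assms by (intro mult_left_mono) auto
  also have "\<dots> \<le> real (w + t + 1)" using assms by simp
  finally have le: "x * p * real (n - (w + t)) \<le> real (w + t + 1)" .
  have "real (w + t + 1) * (x * p * real (n choose (w + t + 1))) =
      (x * p * real (n - (w + t))) * real (n choose (w + t))"
    using abs by (simp add: mult.left_commute mult.assoc)
  also have "\<dots> \<le> real (w + t + 1) * real (n choose (w + t))"
    using le by (intro mult_right_mono) auto
  finally have "x * p * real (n choose (w + t + 1)) \<le> real (n choose (w + t))"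
    by (subst (asm) mult_le_cancel_left_pos) auto
  then have "p ^ t * (p * real (n choose (w + t + 1))) \<le> p ^ t * (real (n choose (w + t)) / x)"
    using assms by (intro mult_left_mono) (auto simp: field_simps)
  also have "\<dots> \<le> real (n choose w) / x ^ t / x"
    using divide_right_mono[OF Suc.IH, of x] assms by simp
  finally show ?case by (simp add: mult_ac)
qed simp

text \<open>Bounds the expected cost of the fragments of size greater than \<open>s\<close> when the random set has
  size about \<open>x p N\<close>.\<close>

definition fragment_weight :: "real \<Rightarrow> nat \<Rightarrow> nat \<Rightarrow> real" where
  "fragment_weight x l s = (\<Sum>t\<in>{s<..l}. real (l choose t) / x ^ t)"

text \<open>For each size \<open>t\<close>, the factor \<open>p ^ t\<close> pays for lowering the
  binomial index from \<open>w + t\<close> to \<open>w\<close>, which makes the counting bound a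
  multiple of the level size.\<close>

lemma sum_large_minimal_residuals_le:
  fixes p x :: real
  assumes "finite X" "H \<subseteq> Pow X" "bounded_family l H"
    and "0 < x" "0 \<le> p" "x * p * real (card X) \<le> real w + 1"
  shows "(\<Sum>W\<in>level X w. \<Sum>T\<in>{T \<in> minimal_sets (residual W H). s < card T}. p ^ card T)
    \<le> fragment_weight x l s * real (card (level X w))"
proof -
  let ?U = "\<lambda>W. {T \<in> minimal_sets (residual W H). s < card T}"
  let ?M = "\<lambda>W t. {T \<in> minimal_sets (residual W H). card T = t}"
  have finM: "finite (minimal_sets (residual W H))" for W
    using residual_Pow[OF assms(2), of W] assms(1)
    by (intro finite_subset[of "minimal_sets (residual W H)" "Pow X"]) (auto simp: minimal_sets_def)
  have group: "(\<Sum>T\<in>?U W. p ^ card T) = (\<Sum>t\<in>{s<..l}. p ^ t * real (card (?M W t)))" for W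
  proof -
    have "card ` ?U W \<subseteq> {s<..l}"
      using bounded_residual[OF assms(1-3), of W] by (auto simp: minimal_sets_def bounded_family_def)
    then have "(\<Sum>T\<in>?U W. p ^ card T) = (\<Sum>t\<in>{s<..l}. \<Sum>T | T \<in> ?U W \<and> card T = t. p ^ card T)"
      using finM by (intro sum.group[symmetric]) auto
    also have "\<dots> = (\<Sum>t\<in>{s<..l}. \<Sum>T\<in>?M W t. p ^ t)"
      by (intro sum.cong) auto
    finally show ?thesis by (simp add: mult.commute)
  qed
  have "(\<Sum>W\<in>level X w. \<Sum>T\<in>?U W. p ^ card T) =
      (\<Sum>t\<in>{s<..l}. p ^ t * real (\<Sum>W\<in>level X w. card (?M W t)))"
    unfolding group by (subst sum.swap) (simp add: sum_distrib_left)
  also have "\<dots> \<le> (\<Sum>t\<in>{s<..l}. p ^ t * real ((card X choose (w + t)) * (l choose t)))"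
    using assms by (intro sum_mono mult_left_mono of_nat_mono sum_card_minimal_residuals_le) auto
  also have "\<dots> \<le> (\<Sum>t\<in>{s<..l}. (real (card X choose w) / x ^ t) * real (l choose t))"
    using mult_right_mono[OF binomial_shift_le[OF assms(4-6)]]
    by (intro sum_mono) (simp add: mult.assoc[symmetric])
  also have "\<dots> = fragment_weight x l s * real (card (level X w))"
    by (simp add: fragment_weight_def card_level assms(1) sum_distrib_left mult_ac)
  finally show ?thesis .
qed

section \<open>Failure bounds and a single round\<close>

text \<open>Only subsets \<open>X\<close> of a fixed \<open>X0\<close> are considered because the sizes of the random sets are
  computed from \<open>card X0\<close> while the ground set shrinks during the process.\<close>

definition miss_bound :: "'a set \<Rightarrow> real \<Rightarrow> nat \<Rightarrow> nat \<Rightarrow> real \<Rightarrow> real \<Rightarrow> bool" where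
  "miss_bound X0 p l m c b \<longleftrightarrow> (\<forall>X H. X \<subseteq> X0 \<longrightarrow> H \<subseteq> Pow X \<longrightarrow> bounded_family l H \<longrightarrow>
    c < cost X p H \<longrightarrow> real (card (misses X H m)) \<le> b * real (card (level X m)))"

lemma miss_boundD:
  assumes "miss_bound X0 p l m c b" "X \<subseteq> X0" "H \<subseteq> Pow X" "bounded_family l H" "c < cost X p H"
  shows "real (card (misses X H m)) \<le> b * real (card (level X m))"
  using assms by (auto simp: miss_bound_def)

lemma miss_bound_trivial:
  assumes "finite X0" "1 \<le> b"
  shows "miss_bound X0 p l m c b"
  unfolding miss_bound_def
proof (intro allI impI)
  fix X and H :: "'a set set" assume "X \<subseteq> X0"
  then have "card (misses X H m) \<le> card (level X m)"
    using assms(1) by (intro misses_le_level) (rule finite_subset)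
  then have "real (card (misses X H m)) \<le> 1 * real (card (level X m))" by simp
  also have "\<dots> \<le> b * real (card (level X m))" using assms(2) by (intro mult_right_mono) auto
  finally show "real (card (misses X H m)) \<le> b * real (card (level X m))" .
qed

text \<open>Positive cost excludes the empty family, and over a finite set the only possible member
  of size 0 is the empty set, which every set includes.\<close>

lemma miss_bound_zero:
  assumes "finite X0" "0 \<le> c"
  shows "miss_bound X0 p 0 m c 0"
  unfolding miss_bound_def
proof (intro allI impI)
  fix X and H :: "'a set set"
  assume X: "X \<subseteq> X0" and H: "H \<subseteq> Pow X" "bounded_family 0 H" "c < cost X p H"
  have "finite X" using X assms(1) by (rule finite_subset)
  have "H \<noteq> {}"
  proof
    assume "H = {}"
    then have "cost X p H \<le> 0"
      using cost_le[OF \<open>finite X\<close>, of "{}" H p] by (auto simp: covers_def)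
    then show False using H(3) assms(2) by simp
  qed
  then obtain S where "S \<in> H" by blast
  moreover have "S = {}"
  proof -
    have "S \<subseteq> X" "card S = 0" using \<open>S \<in> H\<close> H(1,2) by (auto simp: bounded_family_def)
    then show ?thesis using \<open>finite X\<close> finite_subset[of S X] by simp
  qed
  ultimately have "misses X H m = {}"
    by (auto simp: misses_def upset_def level_def)
  then show "real (card (misses X H m)) \<le> 0 * real (card (level X m))" by simp
qed

lemma miss_bound_mono:
  assumes "miss_bound X0 p l m c b" "l' \<le> l" "c \<le> c'" "b \<le> b'"
  shows "miss_bound X0 p l' m c' b'"
  unfolding miss_bound_def
proof (intro allI impI)
  fix X H assume *: "X \<subseteq> X0" "H \<subseteq> Pow X" "bounded_family l' H" "c' < cost X p H"
  have "real (card (misses X H m)) \<le> b * real (card (level X m))"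
    using assms * by (intro miss_boundD[OF assms(1)]) (auto simp: bounded_family_def)
  also have "\<dots> \<le> b' * real (card (level X m))"
    using assms by (intro mult_right_mono) auto
  finally show "real (card (misses X H m)) \<le> b' * real (card (level X m))" .
qed

lemma cost_residual_ge:
  assumes "finite X" "0 \<le> p" "H \<subseteq> Pow X"
  shows "cost X p H \<le> cost (X - W) p (residual W H)"
proof -
  have "\<exists>T\<in>residual W H \<union> {}. T \<subseteq> S" if "S \<in> H" for S
    using that by (auto simp: residual_def)
  then show ?thesis
    using assms residual_Pow[of H X W] cost_le_residual[of X p H "residual W H" "X - W" "{}"] by auto
qed

lemma miss_bound_residual:
  assumes "miss_bound X0 p l m c b" "finite X0" "0 \<le> p"
    and "X \<subseteq> X0" "H \<subseteq> Pow X" "bounded_family l H" "c < cost X p H"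
  shows "real (card (misses (X - W) (residual W H) m)) \<le> b * real (card (level (X - W) m))"
proof (rule miss_boundD[OF assms(1)])
  have "finite X" using assms finite_subset by blast
  then show "bounded_family l (residual W H)" "c < cost (X - W) p (residual W H)"
    using assms bounded_residual cost_residual_ge[of X p H W] by fastforce+
  show "X - W \<subseteq> X0" "residual W H \<subseteq> Pow (X - W)"
    using assms residual_Pow by blast+
qed

text \<open>Exposing \<open>m' - m\<close> points first neither enlarges the members nor lowers the
  cost, so the bound for \<open>m\<close> applies to every residual family.\<close>

lemma miss_bound_add_size:
  assumes "miss_bound X0 p l m c b" "finite X0" "0 \<le> p" "m \<le> m'"
  shows "miss_bound X0 p l m' c b"
  unfolding miss_bound_def
proof (intro allI impI)
  fix X H assume *: "X \<subseteq> X0" "H \<subseteq> Pow X" "bounded_family l H" "c < cost X p H"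
  have "finite X" using * assms finite_subset by blast
  then have "real (card (misses X H ((m' - m) + m))) \<le> b * real (card (level X ((m' - m) + m)))"
    using miss_bound_residual[OF assms(1-3) *]
    by (intro misses_averaging[where \<beta> = "\<lambda>_. b"]) auto
  then show "real (card (misses X H m')) \<le> b * real (card (level X m'))"
    using assms(4) by simp
qed

text \<open>By Markov's inequality the large fragments cost more than \<open>a\<close> for at most a fraction \<open>q\<close> of the
  sets \<open>W\<close>; for those \<open>W\<close> the residual family is kept, so that a failed step can be repeated.\<close>

lemma miss_bound_step:
  fixes p x a q :: real
  assumes small: "miss_bound X0 p s m c' b1" and keep: "miss_bound X0 p l m c b2"
    and "finite X0" "0 \<le> p" "0 < x" "0 < a" "0 \<le> b1" "0 \<le> b2"
    and c: "c' + a \<le> c"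
    and frag: "fragment_weight x l s \<le> q * a"
    and w: "w = nat \<lfloor>x * p * real (card X0)\<rfloor>"
  shows "miss_bound X0 p l (w + m) c (b1 + q * b2)"
  unfolding miss_bound_def
proof (intro allI impI)
  fix X H assume *: "X \<subseteq> X0" "H \<subseteq> Pow X" "bounded_family l H" "c < cost X p H"
  have finX: "finite X" using * assms finite_subset by blast
  let ?U = "\<lambda>W. {T \<in> minimal_sets (residual W H). s < card T}"
  let ?F = "\<lambda>W. {T \<in> minimal_sets (residual W H). card T \<le> s}"
  define Z where "Z W = (\<Sum>T\<in>?U W. p ^ card T)" for W
  define B where "B = {W \<in> level X w. a < Z W}"
  have Z0: "0 \<le> Z W" for W unfolding Z_def using \<open>0 \<le> p\<close> by (intro sum_nonneg) auto
  have finB: "finite B" "finite (level X w)" by (simp_all add: B_def finite_level finX)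
  have "x * p * real (card X) \<le> x * p * real (card X0)"
    using assms * by (intro mult_left_mono) (auto intro: card_mono)
  also have "\<dots> \<le> real w + 1" unfolding w by linarith
  finally have xw: "x * p * real (card X) \<le> real w + 1" .
  have "a * real (card B) = (\<Sum>W\<in>B. a)" by simp
  also have "\<dots> \<le> (\<Sum>W\<in>B. Z W)" by (intro sum_mono) (auto simp: B_def)
  also have "\<dots> \<le> (\<Sum>W\<in>level X w. Z W)"
    using finB Z0 by (intro sum_mono2) (auto simp: B_def)
  also have "\<dots> \<le> fragment_weight x l s * real (card (level X w))"
    unfolding Z_def using finX * \<open>0 < x\<close> \<open>0 \<le> p\<close> xw by (intro sum_large_minimal_residuals_le)
  also have "\<dots> \<le> q * a * real (card (level X w))"
    by (intro mult_right_mono frag) auto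
  finally have "a * real (card B) \<le> a * (q * real (card (level X w)))"
    by (simp add: mult_ac)
  then have cardB: "real (card B) \<le> q * real (card (level X w))"
    using \<open>0 < a\<close> by (subst (asm) mult_le_cancel_left_pos)
  \<comment> \<open>Charging \<open>b1\<close> on every \<open>W\<close>, bad or not, makes the
    average at most \<open>b1 + q * b2\<close>.\<close>
  let ?\<beta> = "\<lambda>W. b1 + (if W \<in> B then b2 else 0)"
  show "real (card (misses X H (w + m))) \<le> (b1 + q * b2) * real (card (level X (w + m)))"
  proof (rule misses_averaging[OF finX])
    fix W assume W: "W \<in> level X w"
    show "real (card (misses (X - W) (residual W H) m)) \<le> ?\<beta> W * real (card (level (X - W) m))"
    proof (cases "W \<in> B")
      case True
      have "real (card (misses (X - W) (residual W H) m)) \<le> b2 * real (card (level (X - W) m))"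
        by (rule miss_bound_residual[OF keep \<open>finite X0\<close> \<open>0 \<le> p\<close> *])
      also have "\<dots> \<le> (b1 + b2) * real (card (level (X - W) m))"
        using \<open>0 \<le> b1\<close> by (intro mult_right_mono) auto
      finally show ?thesis using True by simp
    next
      case False
      have sub: "minimal_sets (residual W H) \<subseteq> Pow (X - W)"
        using residual_Pow[OF *(2), of W] by (auto simp: minimal_sets_def)
      have "finite (residual W H)"
        using residual_Pow[OF *(2), of W] finX finite_subset by fastforce
      have ex: "\<exists>T\<in>?F W \<union> ?U W. T \<subseteq> S" if "S \<in> H" for S
      proof -
        have "S - W \<in> residual W H" using that by (simp add: residual_def)
        with \<open>finite (residual W H)\<close> obtain T where "T \<in> minimal_sets (residual W H)" "T \<subseteq> S - W"
          using minimal_sets_below by blast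
        then show ?thesis by (cases "card T \<le> s") auto
      qed
      have "cost X p H \<le> cost (X - W) p (?F W) + Z W"
        unfolding Z_def
        using finX \<open>0 \<le> p\<close> * sub ex by (intro cost_le_residual) auto
      moreover have "Z W \<le> a" using False W by (auto simp: B_def)
      ultimately have "c' < cost (X - W) p (?F W)" using *(4) c by linarith
      then have "real (card (misses (X - W) (?F W) m)) \<le> b1 * real (card (level (X - W) m))"
        using sub *(1) by (intro miss_boundD[OF small]) (auto simp: bounded_family_def)
      \<comment> \<open>The kept fragments form a subfamily of the residual family, and a subfamily
        is missed at least as often.\<close>
      moreover have "card (misses (X - W) (residual W H) m) \<le> card (misses (X - W) (?F W) m)"
        using finX by (intro card_mono finite_misses misses_mono) (auto simp: minimal_sets_def)
      ultimately show ?thesis using False by simp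
    qed
  next
    have "(\<Sum>W\<in>level X w. ?\<beta> W) = b1 * real (card (level X w)) + b2 * real (card B)"
      using finB by (simp add: sum.distrib sum.If_cases B_def Int_def mult.commute)
    also have "\<dots> \<le> b1 * real (card (level X w)) + b2 * (q * real (card (level X w)))"
      using cardB \<open>0 \<le> b2\<close> by (intro add_left_mono mult_left_mono)
    finally show "(\<Sum>W\<in>level X w. ?\<beta> W) \<le> (b1 + q * b2) * real (card (level X w))"
      by (simp add: algebra_simps)
  qed
qed

section \<open>Weights of large fragments\<close>

text \<open>The indices above \<open>s\<close> are exactly half of row \<open>2 * s + 1\<close>, so
  their binomials sum to \<open>4 ^ s\<close>, while each denominator is at least
  \<open>12 ^ (s + 1)\<close>.\<close>

lemma fragment_weight_halving: "fragment_weight 12 (2 * s + 1) s \<le> (1 / 3) ^ (s + 1) / 4"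
proof -
  have "(\<Sum>t\<le>2 * s + 1. (2 * s + 1) choose t) =
      (\<Sum>t\<le>s. (2 * s + 1) choose t) + (\<Sum>t\<in>{s<..2 * s + 1}. (2 * s + 1) choose t)"
  proof -
    have "{..2 * s + 1} = {..s} \<union> {s<..2 * s + 1}" by auto
    then show ?thesis by (simp only:) (rule sum.union_disjoint, auto)
  qed
  then have upper: "(\<Sum>t\<in>{s<..2 * s + 1}. (2 * s + 1) choose t) = 4 ^ s"
    using choose_row_sum[of "2 * s + 1"] binomial_r_part_sum[of s] by (simp add: power_mult)
  have "fragment_weight 12 (2 * s + 1) s \<le>
      (\<Sum>t\<in>{s<..2 * s + 1}. real ((2 * s + 1) choose t) / 12 ^ (s + 1))"
    unfolding fragment_weight_def
    by (intro sum_mono divide_left_mono power_increasing) auto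
  also have "\<dots> = real (\<Sum>t\<in>{s<..2 * s + 1}. (2 * s + 1) choose t) / 12 ^ (s + 1)"
    by (simp add: sum_divide_distrib)
  also have "\<dots> = 4 ^ s / 12 ^ (s + 1)" unfolding upper by simp
  also have "\<dots> = (4 / 12) ^ s / 12" unfolding power_divide by simp
  finally show ?thesis by simp
qed

text \<open>Fragment sizes exceed \<open>d * l\<close>, so each denominator is at least
  \<open>(x powr d) ^ l\<close>; the whole row of binomials sums to \<open>2 ^ l\<close>.\<close>

lemma fragment_weight_powr_le:
  assumes "1 \<le> x" "0 \<le> d"
  shows "fragment_weight x l (nat \<lfloor>d * real l\<rfloor>) \<le> (2 / x powr d) ^ l"
proof -
  have "real (l choose t) / x ^ t \<le> real (l choose t) / (x powr d) ^ l"
    if "t \<in> {nat \<lfloor>d * real l\<rfloor><..l}" for t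
  proof -
    have "(x powr d) ^ l = x powr (d * real l)"
      using assms by (simp add: powr_realpow[symmetric] powr_powr)
    also have "\<dots> \<le> x powr real t"
      using that assms by (intro powr_mono) (auto, linarith)
    also have "\<dots> = x ^ t" using assms by (simp add: powr_realpow)
    finally show ?thesis using assms by (intro divide_left_mono) auto
  qed
  then have "fragment_weight x l (nat \<lfloor>d * real l\<rfloor>) \<le>
      (\<Sum>t\<in>{nat \<lfloor>d * real l\<rfloor><..l}. real (l choose t) / (x powr d) ^ l)"
    unfolding fragment_weight_def by (rule sum_mono)
  also have "\<dots> \<le> (\<Sum>t\<le>l. real (l choose t) / (x powr d) ^ l)"
    using assms by (intro sum_mono2) auto
  also have "\<dots> = real (\<Sum>t\<le>l. l choose t) / (x powr d) ^ l"
    by (simp add: sum_divide_distrib)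
  also have "\<dots> = (2 / x powr d) ^ l"
    by (simp only: choose_row_sum) (simp add: power_divide)
  finally show ?thesis .
qed

section \<open>Repeated halving, and the descent\<close>

text \<open>Each repetition gains a factor \<open>1/2 = 1/3 + 1/6\<close>, where \<open>1/3\<close> is the ratio of the bounds of
  two consecutive sizes and \<open>1/6\<close> is the probability that a halving step fails. At size \<open>1\<close> a success
  leaves no failure at all, so there a failure probability of \<open>1/2\<close> is affordable.\<close>

lemma miss_bound_halving:
  assumes "finite X0" "0 \<le> p" "w = nat \<lfloor>12 * p * real (card X0)\<rfloor>"
  shows "miss_bound X0 p (2 ^ Suc i - 1) (k * w) (3 / 8 - 3 / 16 * (1 / 9) ^ i) ((1 / 2) ^ k * 3 ^ i)"
proof (induction i arbitrary: k)
  case 0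
  show ?case
  proof (induction k)
    case 0
    show ?case by (rule miss_bound_trivial) (use assms in auto)
  next
    case (Suc k)
    \<comment> \<open>The weight is at most \<open>1/12 = 1/2 * 1/6\<close>: failure probability
      \<open>1/2\<close> and loss \<open>1/6\<close>, which is below the threshold
      \<open>3/16\<close>.\<close>
    have "miss_bound X0 p (2 ^ Suc 0 - 1) (w + k * w) (3 / 8 - 3 / 16 * (1 / 9) ^ 0)
        (0 + 1 / 2 * ((1 / 2) ^ k * 3 ^ 0))"
    proof (rule miss_bound_step[OF miss_bound_zero[OF assms(1), of 0] Suc.IH])
      show "fragment_weight 12 (2 ^ Suc 0 - 1) 0 \<le> 1 / 2 * (1 / 6)"
        using fragment_weight_halving[of 0] by simp
    qed (use assms in auto)
    then show ?case by simp
  qed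
next
  case (Suc i)
  note IH = Suc.IH
  show ?case
  proof (induction k)
    case 0
    have "1 \<le> (3::real) ^ Suc i" by (rule one_le_power) simp
    then show ?case using assms(1) by (simp only: power_0 mult_1 miss_bound_trivial)
  next
    case (Suc k)
    \<comment> \<open>The loss \<open>1/6 * (1/9) ^ i\<close> is exactly the difference of
      consecutive cost thresholds, which tend to \<open>3/8\<close>; the weight is at most
      \<open>(1/9) ^ (i + 1) / 4\<close>, which is \<open>1/6\<close> of this loss.\<close>
    have "miss_bound X0 p (2 ^ Suc (Suc i) - 1) (w + k * w) (3 / 8 - 3 / 16 * (1 / 9) ^ Suc i)
        ((1 / 2) ^ k * 3 ^ i + 1 / 6 * ((1 / 2) ^ k * 3 ^ Suc i))"
    proof (rule miss_bound_step[OF IH Suc.IH])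
      have "1 \<le> (2::nat) ^ Suc i" by (rule one_le_power) simp
      then have "2 * (2 ^ Suc i - 1) + 1 = (2::nat) ^ Suc (Suc i) - 1"
        unfolding power_Suc[of _ "Suc i"] by linarith
      moreover have "Suc i \<le> 2 ^ i"
        using less_exp[of i] by linarith
      then have "(1 / 3 :: real) ^ (2 ^ Suc i) \<le> (1 / 3) ^ (2 * Suc i)"
        by (intro power_decreasing) auto
      ultimately show "fragment_weight 12 (2 ^ Suc (Suc i) - 1) (2 ^ Suc i - 1)
          \<le> 1 / 6 * (1 / 6 * (1 / 9) ^ i)"
        using fragment_weight_halving[of "2 ^ Suc i - 1"]
        by (simp add: power_mult power_one_over power2_eq_square)
    qed (use assms in \<open>auto simp: algebra_simps\<close>)
    then show ?case by (simp add: algebra_simps)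
  qed
qed

text \<open>With \<open>2 ^ i \<le> l < 2 ^ (i + 1)\<close>, the factor \<open>3 ^ i\<close> of the
  halving bound is offset by \<open>8/5 * log 2 l\<close> rounds, because \<open>3 ^ 5 = 243\<close>
  is below \<open>2 ^ 8 = 256\<close>.\<close>

lemma miss_bound_endgame:
  fixes b M :: real
  assumes "finite X0" "0 \<le> p" "1 \<le> l" "0 < b"
    and k: "log 2 (1 / b) + 8 / 5 * log 2 (real l) \<le> real k"
    and M: "12 * p * real (card X0) * real k \<le> M"
  shows "miss_bound X0 p l (nat \<lfloor>M\<rfloor>) (3 / 8) b"
proof -
  define w where "w = nat \<lfloor>12 * p * real (card X0)\<rfloor>"
  obtain i where i: "2 ^ i \<le> l" "l < 2 ^ (i + 1)"
    using ex_power_ivl1[of 2 l] \<open>1 \<le> l\<close> by auto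
  have "real i = log 2 (real (2 ^ i))" by (simp add: log_nat_power)
  also have "\<dots> \<le> log 2 (real l)"
    using i(1) \<open>1 \<le> l\<close> by (subst log_le_cancel_iff) (auto simp: of_nat_le_iff[symmetric] simp del: of_nat_le_iff)
  finally have il: "real i \<le> log 2 (real l)" .
  have "(3::real) ^ 5 \<le> (2 powr (8 / 5)) ^ 5"
    by (simp add: powr_realpow[symmetric] powr_powr)
  then have "3 \<le> (2::real) powr (8 / 5)"
    by (subst (asm) power_mono_iff) auto
  then have "(3::real) ^ i \<le> (2 powr (8 / 5)) ^ i" by (intro power_mono) auto
  also have "\<dots> = 2 powr (8 / 5 * real i)" by (simp add: powr_realpow[symmetric] powr_powr)
  also have "\<dots> \<le> 2 powr (real k - log 2 (1 / b))" using k il by (intro powr_mono) auto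
  also have "\<dots> = 2 ^ k * b"
    using \<open>0 < b\<close> by (simp add: powr_diff powr_realpow)
  finally have le_b: "(1 / 2) ^ k * 3 ^ i \<le> b"
    by (simp add: power_one_over field_simps)
  have "real (k * w) \<le> real k * (12 * p * real (card X0))"
    using assms(2) unfolding w_def of_nat_mult by (intro mult_left_mono) auto
  also have "\<dots> \<le> M" using M by (simp add: mult_ac)
  finally have kw: "k * w \<le> nat \<lfloor>M\<rfloor>" by linarith
  have "miss_bound X0 p (2 ^ Suc i - 1) (k * w) (3 / 8 - 3 / 16 * (1 / 9) ^ i) ((1 / 2) ^ k * 3 ^ i)"
    by (rule miss_bound_halving) (use assms w_def in auto)
  then have "miss_bound X0 p l (k * w) (3 / 8) b"
    by (rule miss_bound_mono) (use i le_b in auto)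
  then show ?thesis using assms(1,2) kw by (rule miss_bound_add_size)
qed

text \<open>\<open>P\<close> marks the sizes at which the descent \<open>l \<mapsto> \<lfloor>d l\<rfloor>\<close> stops. The losses \<open>v l\<close> at least double
  from one size to the next, so the loss still to be suffered from \<open>l\<close> on is at most
  \<open>2 V - v l\<close>; the minimum makes this meaningful at terminal sizes too.\<close>

lemma miss_bound_descent:
  fixes v :: "nat \<Rightarrow> real" and p x A B V b c d :: real
  assumes "finite X0" "0 \<le> p" "0 < d" "d < 1" "0 < x" "0 \<le> A" "0 \<le> B" "0 \<le> b" "0 \<le> V"
    and xA: "x * p * real (card X0) = A * log 2 (1 / d)"
    and base: "\<And>l. 1 \<le> l \<Longrightarrow> P l \<Longrightarrow> miss_bound X0 p l (nat \<lfloor>A * log 2 (real l) + B\<rfloor>) c b"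
    and descend: "\<And>l. 1 \<le> l \<Longrightarrow> \<not> P l \<Longrightarrow> 1 \<le> d * real l"
    and v0: "\<And>l. 0 < v l"
    and vV: "\<And>l. \<not> P l \<Longrightarrow> v l \<le> V"
    and v2: "\<And>l. \<not> P l \<Longrightarrow> 2 * v l \<le> v (nat \<lfloor>d * real l\<rfloor>)"
    and frag: "\<And>l. \<not> P l \<Longrightarrow> fragment_weight x l (nat \<lfloor>d * real l\<rfloor>) \<le> v l * v l"
    and "1 \<le> l"
  shows "miss_bound X0 p l (nat \<lfloor>A * log 2 (real l) + B\<rfloor>)
    (c + (2 * V - min (2 * V) (v l))) (b + (2 * V - min (2 * V) (v l)))"
  using \<open>1 \<le> l\<close>
proof (induction l rule: less_induct)
  case (less l)
  let ?M = "\<lambda>l. A * log 2 (real l) + B"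
  show ?case
  proof (cases "P l")
    case True
    then show ?thesis
      using less.prems by (intro miss_bound_mono[OF base]) auto
  next
    case False
    define l' where "l' = nat \<lfloor>d * real l\<rfloor>"
    define w where "w = nat \<lfloor>x * p * real (card X0)\<rfloor>"
    have "1 \<le> d * real l" using descend less.prems False by blast
    then have l': "1 \<le> l'" "real l' \<le> d * real l"
      unfolding l'_def by linarith+
    have "d * real l < 1 * real l"
      using assms(4) less.prems by (intro mult_strict_right_mono) auto
    then have "l' < l" using l'(2) by simp
    have "log 2 (real l') \<le> log 2 (d * real l)"
      using l' assms(3) less.prems by simp
    also have "\<dots> = log 2 (real l) - log 2 (1 / d)"
      using assms(3) less.prems by (simp add: log_mult log_divide)
    finally have "A * (log 2 (real l') + log 2 (1 / d)) \<le> A * log 2 (real l)"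
      using assms(6) by (intro mult_left_mono) auto
    then have "x * p * real (card X0) + ?M l' \<le> ?M l"
      unfolding xA by (simp add: algebra_simps)
    moreover have "0 \<le> x * p * real (card X0)" "0 \<le> ?M l'"
      using assms l' by auto
    ultimately have size: "w + nat \<lfloor>?M l'\<rfloor> \<le> nat \<lfloor>?M l\<rfloor>"
      unfolding w_def by linarith
    have v: "0 < v l" "v l \<le> V" "2 * v l \<le> v l'"
      using v0 vV v2 False unfolding l'_def by blast+
    \<comment> \<open>Loss and failure probability are both \<open>v l\<close>; a failed round is
      not repeated but charged the trivial bound 1.\<close>
    have "miss_bound X0 p l (w + nat \<lfloor>?M l'\<rfloor>) (c + (2 * V - min (2 * V) (v l)))
      ((b + (2 * V - min (2 * V) (v l'))) + v l * 1)"
    proof (rule miss_bound_step[OF less.IH[OF \<open>l' < l\<close> l'(1)] miss_bound_trivial[OF assms(1)]])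
      show "fragment_weight x l l' \<le> v l * v l"
        unfolding l'_def by (rule frag[OF False])
    qed (use assms v w_def in auto)
    then have "miss_bound X0 p l (w + nat \<lfloor>?M l'\<rfloor>) (c + (2 * V - min (2 * V) (v l)))
      (b + (2 * V - min (2 * V) (v l)))"
      by (rule miss_bound_mono) (use v in auto)
    then show ?thesis using assms(1,2) size by (rule miss_bound_add_size)
  qed
qed

section \<open>Estimates for powers of two\<close>

lemma two_powr_ge:
  fixes t :: real
  assumes "0 \<le> t"
  shows "1 + t / 2 \<le> 2 powr t"
proof -
  have "exp (1 / 2 :: real) ^ 2 \<le> 2 ^ 2"
    using exp_le by (simp add: exp_double[symmetric])
  then have "exp (1 / 2 :: real) \<le> 2"
    by (rule power2_le_imp_le) simp
  then have "1 / 2 \<le> ln (2 :: real)" by (subst ln_ge_iff) auto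
  then have "t * (1 / 2) \<le> t * ln 2" using assms by (intro mult_left_mono)
  also have "1 + t * ln 2 \<le> exp (t * ln 2)" by simp
  finally show ?thesis by (simp add: powr_def)
qed

text \<open>Applied with \<open>u = 1 / \<delta>\<close>: together with
  \<open>2 powr (1 / \<delta>) \<le> L * log 2 (1 / \<delta>)\<close> it yields
  \<open>20 \<le> L\<close>.\<close>

lemma log_le_two_powr:
  fixes u :: real
  assumes "8 \<le> u"
  shows "20 * log 2 u \<le> 2 powr u"
proof -
  have "20 * u \<le> 256 * (1 + (u - 8) / 2)" using assms by (simp add: field_simps)
  also have "\<dots> \<le> 256 * 2 powr (u - 8)"
    using assms by (intro mult_left_mono two_powr_ge) auto
  also have "\<dots> = 2 powr u"
    using powr_add[of 2 "u - 8" 8] by simp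
  finally have "20 * u \<le> 2 powr u" .
  moreover from this have "log 2 u \<le> u"
    using assms by (subst log_le_iff) auto
  ultimately show ?thesis by linarith
qed

section \<open>Choice of parameters and assembly of the two phases\<close>

theorem theorem5:
  fixes \<delta> L \<epsilon> p \<epsilon>1 :: real
    and l0 N l m :: nat
    and X :: "'a set" and H :: "'a set set"
  assumes "0 < \<delta>" "\<delta> < 1" "L > 0"
    and "\<epsilon> = (L * log 2 (1 / \<delta>)) powr \<delta> / 2 - 1"
    and "0 < \<epsilon>" "\<epsilon> < 3"
    and "2 \<le> (1 + \<epsilon> / 3) powi (int l0 - \<lfloor>\<delta> * real l0\<rfloor>)"
    and "finite X" "card X = N"
    and "0 \<le> p" "p \<le> 1"
    and "0 < \<epsilon>1" "\<epsilon>1 < 1 / real l0"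
    and "H \<subseteq> Pow X" "bounded_family l H"
    and "cost X p H > 1 / 2"
    and "m = nat \<lfloor>L * p * real N * log 2 (real l + 1) + 96 * p * real N * log 2 (1 / \<epsilon>1)\<rfloor>"
  shows "real (card (upset X H \<inter> level X m)) \<ge> (1 - \<epsilon>1) * real (card (level X m))"
proof -
  define K where "K = log 2 (1 / \<epsilon>1)"
  define x where "x = L * log 2 (1 / \<delta>)"
  define y where "y = 1 + \<epsilon> / 3"
  \<comment> \<open>At this threshold \<open>y powr T\<close> is at least
    \<open>2 powr (K + 3) = 8 / \<epsilon>1\<close>, so every loss above it is at most
    \<open>\<epsilon>1 / 8\<close>.\<close>
  define T where "T = real l0 * (K + 3)"
  define v where "v j = (1 / y) ^ j" for j :: nat
  \<comment> \<open>If \<open>\<delta> j < 1\<close>, a further step would use up more of the random set than is available; but a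
    terminal size \<open>j\<close> above \<open>T\<close> can only occur if \<open>1 / \<delta>\<close> is large, and then \<open>L\<close> is large enough to pay
    for the halving.\<close>
  define P where "P j \<longleftrightarrow> real j \<le> T \<or> \<delta> * real j < 1" for j :: nat
  define A where "A = L * p * real N"
  define B where "B = 96 * p * real N * K"
  have y: "1 < y" "y < 2" using assms by (auto simp: y_def)
  \<comment> \<open>One descent from \<open>l0\<close> lowers the size by \<open>g\<close>; the
    hypothesis on \<open>l0\<close> says that this at least doubles the loss.\<close>
  define g where "g = l0 - nat \<lfloor>\<delta> * real l0\<rfloor>"
  have dl0: "0 \<le> \<lfloor>\<delta> * real l0\<rfloor>" "\<lfloor>\<delta> * real l0\<rfloor> \<le> int l0"
  proof -
    show "0 \<le> \<lfloor>\<delta> * real l0\<rfloor>" using assms(1) by simp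
    have "\<delta> * real l0 \<le> 1 * real l0" using assms(2) by (intro mult_right_mono) auto
    then show "\<lfloor>\<delta> * real l0\<rfloor> \<le> int l0" by (simp add: floor_le_iff)
  qed
  then have "int l0 - \<lfloor>\<delta> * real l0\<rfloor> = int g" by (simp add: g_def)
  then have yg: "2 \<le> y ^ g" using assms(7) by (simp add: y_def)
  have "g \<noteq> 0" "g \<noteq> 1" using yg y by (auto intro: Nat.gr0I)
  moreover have "g \<le> l0" by (simp add: g_def)
  ultimately have l0: "2 \<le> l0" by linarith
  have e1: "\<epsilon>1 < 1 / 2"
  proof -
    have "1 / real l0 \<le> 1 / 2" using l0 by (intro divide_left_mono) auto
    then show ?thesis using assms(13) by linarith
  qed
  have l0K: "log 2 (real l0) \<le> K"
    using assms(12,13) l0 unfolding K_def by (subst log_le_cancel_iff) (auto simp: field_simps)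
  have K: "1 \<le> K"
  proof -
    have "log 2 2 \<le> log 2 (real l0)" using l0 by (subst log_le_cancel_iff) auto
    then show ?thesis using l0K by simp
  qed
  have T: "8 \<le> T"
  proof -
    have "2 * 4 \<le> real l0 * (K + 3)" using l0 K by (intro mult_mono) auto
    then show ?thesis by (simp add: T_def)
  qed
  have lgd: "0 < log 2 (1 / \<delta>)" using assms(1,2) by simp
  have x0: "0 < x" using assms(3) lgd by (simp add: x_def)
  have xd: "x powr \<delta> = 2 * (1 + \<epsilon>)" using assms(4) by (simp add: x_def)
  have x_eq: "x = (2 * (1 + \<epsilon>)) powr (1 / \<delta>)"
    unfolding xd[symmetric] using x0 assms(1) by (simp add: powr_powr)
  have "2 powr (1 / \<delta>) \<le> x"
    unfolding x_eq using assms by (intro powr_mono2) auto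
  moreover have "1 \<le> 2 powr (1 / \<delta>)" using assms(1) by (intro ge_one_powr_ge_zero) auto
  ultimately have x2: "2 powr (1 / \<delta>) \<le> x" "1 \<le> x" by linarith+
  have base: "miss_bound X p j (nat \<lfloor>A * log 2 (real j) + B\<rfloor>) (3 / 8) (\<epsilon>1 / 2)"
    if j: "1 \<le> j" "P j" for j
  proof -
    \<comment> \<open>The summand 1 brings the failure bound down to \<open>\<epsilon>1 / 2\<close>,
      leaving the other half for the descent.\<close>
    define k where "k = nat \<lceil>K + 1 + 8 / 5 * log 2 (real j)\<rceil>"
    have lgj: "0 \<le> log 2 (real j)" using j by simp
    have k: "K + 1 + 8 / 5 * log 2 (real j) \<le> real k" "real k \<le> K + 2 + 8 / 5 * log 2 (real j)"
      unfolding k_def using K lgj by linarith+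
    have "12 * real k \<le> L * log 2 (real j) + 96 * K"
    proof (cases "real j \<le> T")
      case True
      have "log 2 (real j) \<le> log 2 T" using True j T by simp
      also have "\<dots> = log 2 (real l0) + log 2 (K + 3)"
        using l0 K by (simp add: T_def log_mult)
      also have "log 2 (K + 3) \<le> K + 1"
      proof -
        have "K + 3 \<le> 4 * (1 + (K - 1) / 2)" using K by (simp add: field_simps)
        also have "\<dots> \<le> 4 * 2 powr (K - 1)"
          using K by (intro mult_left_mono two_powr_ge) auto
        also have "\<dots> = 2 powr (K + 1)"
          using powr_add[of 2 "K - 1" 2] by (simp add: add.commute)
        finally have "K + 3 \<le> 2 powr (K + 1)" .
        then show ?thesis using K by (subst log_le_iff) auto
      qed
      finally have "log 2 (real j) \<le> 2 * K + 1" using l0K by simp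
      \<comment> \<open>\<open>12 * (K + 2 + 8/5 * (2 * K + 1))\<close> is at most
        \<open>96 * K\<close> because \<open>1 \<le> K\<close>.\<close>
      then have "12 * real k \<le> 96 * K" using k(2) K by simp
      moreover have "0 \<le> L * log 2 (real j)" using assms(3) lgj by simp
      ultimately show ?thesis by linarith
    next
      case False
      then have "\<delta> * real j < 1" using j by (auto simp: P_def)
      then have "real j < 1 / \<delta>" using assms(1) by (simp add: field_simps)
      then have u: "8 \<le> 1 / \<delta>" using False T by linarith
      \<comment> \<open>The rounds need \<open>12 * 8/5 = 19.2\<close> times \<open>log 2 j\<close>,
        so \<open>20 \<le> L\<close> is enough.\<close>
      have "20 * log 2 (1 / \<delta>) \<le> L * log 2 (1 / \<delta>)"
        using log_le_two_powr[OF u] x2(1) unfolding x_def by linarith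
      then have "20 \<le> L" using lgd by (simp only: mult_le_cancel_right_pos)
      then have "20 * log 2 (real j) \<le> L * log 2 (real j)"
        using lgj by (intro mult_right_mono)
      then show ?thesis using k(2) K lgj by linarith
    qed
    then have "p * real N * (12 * real k) \<le> p * real N * (L * log 2 (real j) + 96 * K)"
      using assms(10) by (intro mult_left_mono) auto
    then have "12 * p * real (card X) * real k \<le> A * log 2 (real j) + B"
      by (simp add: A_def B_def assms(9) algebra_simps)
    moreover have "log 2 (1 / (\<epsilon>1 / 2)) + 8 / 5 * log 2 (real j) \<le> real k"
      using k(1) assms(12) by (simp add: K_def log_divide log_mult)
    ultimately show ?thesis
      using assms(8,10,12) j(1) by (intro miss_bound_endgame) auto
  qed
  have big: "real l0 * (K + 3) < real j" if "\<not> P j" for j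
    using that by (simp add: P_def T_def)
  have vV: "v j \<le> \<epsilon>1 / 8" if "\<not> P j" for j
  proof -
    have "8 / \<epsilon>1 = 2 powr (K + 3)"
      using assms(12) by (simp add: K_def powr_add)
    also have "\<dots> \<le> (y ^ g) powr (K + 3)"
      using yg K by (intro powr_mono2) auto
    also have "\<dots> \<le> (y ^ l0) powr (K + 3)"
      using y K \<open>g \<le> l0\<close> by (intro powr_mono2 power_increasing) auto
    also have "\<dots> = y powr (real l0 * (K + 3))"
      using y by (simp add: powr_realpow[symmetric] powr_powr)
    also have "\<dots> \<le> y powr real j"
      using big[OF that] y by (intro powr_mono) auto
    also have "\<dots> = y ^ j" using y by (simp add: powr_realpow)
    finally show ?thesis using assms(12) y by (simp add: v_def power_one_over field_simps)
  qed
  have v2: "2 * v j \<le> v (nat \<lfloor>\<delta> * real j\<rfloor>)" if "\<not> P j" for j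
  proof -
    have "real l0 * 1 \<le> real l0 * (K + 3)" using K by (intro mult_left_mono) auto
    then have "real l0 \<le> real j" using big[OF that] by linarith
    \<comment> \<open>\<open>(1 - \<delta>) * j\<close> grows with \<open>j\<close>, so from any
      size above \<open>l0\<close> a descent also removes at least \<open>g\<close>.\<close>
    then have "\<delta> * (real j - real l0) \<le> 1 * (real j - real l0)"
      using assms(2) by (intro mult_right_mono) auto
    then have "real l0 + \<delta> * real j \<le> real j + \<delta> * real l0"
      by (simp add: algebra_simps)
    then have "int l0 + \<lfloor>\<delta> * real j\<rfloor> \<le> int j + \<lfloor>\<delta> * real l0\<rfloor>" by linarith
    then have "\<lfloor>\<delta> * real j\<rfloor> + int g \<le> int j"
      using \<open>int l0 - \<lfloor>\<delta> * real l0\<rfloor> = int g\<close> by linarith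
    moreover have "0 \<le> \<lfloor>\<delta> * real j\<rfloor>" using assms(1) by simp
    ultimately have "nat \<lfloor>\<delta> * real j\<rfloor> + g \<le> j" by linarith
    then have "y ^ nat \<lfloor>\<delta> * real j\<rfloor> * y ^ g \<le> y ^ j"
      using y by (simp add: power_add[symmetric] power_increasing)
    moreover have "y ^ nat \<lfloor>\<delta> * real j\<rfloor> * 2 \<le> y ^ nat \<lfloor>\<delta> * real j\<rfloor> * y ^ g"
      using yg y by (intro mult_left_mono) auto
    ultimately have "y ^ nat \<lfloor>\<delta> * real j\<rfloor> * 2 \<le> y ^ j" by linarith
    then show ?thesis using y by (simp add: v_def power_one_over field_simps)
  qed
  have frag: "fragment_weight x j (nat \<lfloor>\<delta> * real j\<rfloor>) \<le> v j * v j" for j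
  proof -
    have "fragment_weight x j (nat \<lfloor>\<delta> * real j\<rfloor>) \<le> (2 / x powr \<delta>) ^ j"
      using x2(2) assms(1) by (intro fragment_weight_powr_le) auto
    also have "2 / x powr \<delta> = 1 / (1 + \<epsilon>)"
      using assms(5) unfolding xd by (simp add: field_simps)
    also have "(1 / (1 + \<epsilon>)) ^ j \<le> (1 / (y * y)) ^ j"
    proof (intro power_mono divide_left_mono)
      \<comment> \<open>\<open>y * y = 1 + 2/3 * \<epsilon> + \<epsilon> * \<epsilon> / 9\<close>,
        which \<open>\<epsilon> < 3\<close> keeps below \<open>1 + \<epsilon>\<close>.\<close>
      have "\<epsilon> * \<epsilon> \<le> 3 * \<epsilon>" using assms(5,6) by (intro mult_right_mono) auto
      then show "y * y \<le> 1 + \<epsilon>" by (simp add: y_def algebra_simps)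
    qed (use assms(5) y in auto)
    also have "\<dots> = v j * v j" by (simp add: v_def power_mult_distrib power_one_over)
    finally show ?thesis .
  qed
  have "real (card (misses X H m)) \<le> \<epsilon>1 * real (card (level X m))"
  proof (cases "l = 0")
    case True
    have "real (card (misses X H m)) \<le> 0 * real (card (level X m))"
      using True assms by (intro miss_boundD[OF miss_bound_zero[of X "1 / 2"]]) auto
    then show ?thesis using assms(12) by simp
  next
    case False
    have "miss_bound X p l (nat \<lfloor>A * log 2 (real l) + B\<rfloor>)
      (3 / 8 + (2 * (\<epsilon>1 / 8) - min (2 * (\<epsilon>1 / 8)) (v l)))
      (\<epsilon>1 / 2 + (2 * (\<epsilon>1 / 8) - min (2 * (\<epsilon>1 / 8)) (v l)))"
    proof (rule miss_bound_descent[where P = P and d = \<delta> and x = x])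
      show "x * p * real (card X) = A * log 2 (1 / \<delta>)"
        by (simp add: x_def A_def assms(9))
      show "1 \<le> \<delta> * real j" if "\<not> P j" for j
        using that by (simp add: P_def)
      show "0 < v j" for j using y by (simp add: v_def)
      show "0 \<le> A" "0 \<le> B" using assms K by (auto simp: A_def B_def)
    qed (use assms x0 base vV v2 frag False in auto)
    then have "miss_bound X p l (nat \<lfloor>A * log 2 (real l) + B\<rfloor>) (1 / 2) \<epsilon>1"
    proof (rule miss_bound_mono)
      \<comment> \<open>The descent loses at most \<open>\<epsilon>1 / 4\<close>, which is below
        \<open>1/8 = 1/2 - 3/8\<close> as \<open>\<epsilon>1 < 1/2\<close>.\<close>
      have "0 \<le> min (2 * (\<epsilon>1 / 8)) (v l)" using assms(12) y by (simp add: v_def)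
      then show "3 / 8 + (2 * (\<epsilon>1 / 8) - min (2 * (\<epsilon>1 / 8)) (v l)) \<le> 1 / 2"
        and "\<epsilon>1 / 2 + (2 * (\<epsilon>1 / 8) - min (2 * (\<epsilon>1 / 8)) (v l)) \<le> \<epsilon>1"
        using e1 assms(12) by linarith+
    qed simp
    moreover have "nat \<lfloor>A * log 2 (real l) + B\<rfloor> \<le> m"
    proof -
      have "A * log 2 (real l) \<le> A * log 2 (real l + 1)"
        using False assms by (intro mult_left_mono) (auto simp: A_def)
      then show ?thesis
        unfolding assms(17) by (intro nat_mono floor_mono) (simp add: A_def B_def K_def)
    qed
    ultimately have "miss_bound X p l m (1 / 2) \<epsilon>1"
      using assms(8,10) by (blast intro: miss_bound_add_size)
    then show ?thesis using assms by (auto intro: miss_boundD)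
  qed
  moreover have "card (level X m) = card (upset X H \<inter> level X m) + card (misses X H m)"
    unfolding misses_def using finite_level[OF assms(8)]
    by (metis Int_commute card_Int_Diff)
  ultimately show ?thesis by (simp add: algebra_simps)
qed

end
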